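(* Let $K$ be an algebraically closed field of characteristic other than $2$, and let $\mathfrak p$ be the Poincaré algebra over $K$. Then the only ideals of $\mathfrak p$ are $0$, $\mathfrak r$, $\mathfrak i$, $\mathfrak j$ and $\mathfrak p$.
   Context: $\mathfrak o_4(K)$ is the Lie algebra of skew-symmetric $4\times4$ matrices over $K$. Vectors in $K^4$ are row vectors. The Poincaré algebra is the $10$-dimensional Lie algebra $$\mathfrak p=\left\{\begin{pmatrix}0&v\\0&M\end{pmatrix}: v\in K^4,\ M\in\mathfrak o_4(K)\right\},\qquad \left[\begin{pmatrix}0&v\\0&M\end{pmatrix},\begin{pmatrix}0&v'\\0&M'\end{pmatrix}\right]=\begin{pmatrix}0&vM'-v'M\\0&[M,M']\end{pmatrix}.$$ For a subset $S\subset\mathfrak o_4(K)$ write $\begin{pmatrix}0&K^4\\0&S\end{pmatrix}$ for the set of such matrices with $v\in K^4$, $M\in S$. Put $\mathfrak r=\begin{pmatrix}0&K^4\\0&0\end{pmatrix}$. Since $K$ is algebraically closed of characteristic $\neq2$, $\mathfrak o_4(K)=I\oplus J$ for two ideals $I\cong J\cong\mathfrak{sl}_2(K)$; explicitly, with $a_{ij}=e_{ij}-e_{ji}$ ($e_{ij}$ the elementary matrices), $I=\mathrm{span}(a_{12}+a_{34},\,a_{13}-a_{24},\,a_{14}+a_{23})$ and $J=\mathrm{span}(a_{12}-a_{34},\,a_{13}+a_{24},\,a_{14}-a_{23})$. Put $\mathfrak i=\begin{pmatrix}0&K^4\\0&I\end{pmatrix}$ and $\mathfrak j=\begin{pmatrix}0&K^4\\0&J\end{pmatrix}$.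 *)

theory Defs
  imports "HOL-Analysis.Cartesian_Space" "HOL-Computational_Algebra.Polynomial"
begin

definition matrix_scale :: "'a::field \<Rightarrow> 'a^'n^'m \<Rightarrow> 'a^'n^'m" where
  "matrix_scale c A = (\<chi> i j. c * A $ i $ j)"

global_interpretation msp: vector_space "matrix_scale :: 'a::field \<Rightarrow> 'a^'n^'m \<Rightarrow> 'a^'n^'m"
  by unfold_locales (simp_all add: matrix_scale_def vec_eq_iff algebra_simps)

definition lie_bracket :: "'a::field^'n^'n \<Rightarrow> 'a^'n^'n \<Rightarrow> 'a^'n^'n" where
  "lie_bracket A B = A ** B - B ** A"

text \<open>Lie algebras are represented by their carriers inside the square matrices, with the
  commutator as bracket.\<close>

definition lie_subalgebra :: "('a::field^'n^'n) set \<Rightarrow> bool" where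
  "lie_subalgebra g \<longleftrightarrow> msp.subspace g \<and> (\<forall>x\<in>g. \<forall>y\<in>g. lie_bracket x y \<in> g)"

definition lie_ideal :: "('a::field^'n^'n) set \<Rightarrow> ('a^'n^'n) set \<Rightarrow> bool" where
  "lie_ideal g h \<longleftrightarrow> h \<subseteq> g \<and> msp.subspace h \<and> (\<forall>x\<in>g. \<forall>y\<in>h. lie_bracket x y \<in> h)"

definition o4 :: "('a::field^4^4) set" where
  "o4 = {M. transpose M = - M}"

definition elem_mat :: "4 \<Rightarrow> 4 \<Rightarrow> 'a::field^4^4" where
  "elem_mat i j = axis i (axis j 1)"

text \<open>The indices are elements of the type \<open>4\<close>, where the numeral \<open>4\<close> denotes the same
  element as \<open>0\<close>; so \<open>1, 2, 3, 4\<close> are its four distinct elements.\<close>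

definition skew_elem :: "4 \<Rightarrow> 4 \<Rightarrow> 'a::field^4^4" where
  "skew_elem i j = elem_mat i j - elem_mat j i"

definition o4_I :: "('a::field^4^4) set" where
  "o4_I = msp.span {skew_elem 1 2 + skew_elem 3 4,
                    skew_elem 1 3 - skew_elem 2 4,
                    skew_elem 1 4 + skew_elem 2 3}"

definition o4_J :: "('a::field^4^4) set" where
  "o4_J = msp.span {skew_elem 1 2 - skew_elem 3 4,
                    skew_elem 1 3 + skew_elem 2 4,
                    skew_elem 1 4 - skew_elem 2 3}"

text \<open>The $5 \times 5$ block matrix with zero first column, first row \<open>(0, v)\<close> and lower right
  block \<open>M\<close>. The index type \<open>4 option\<close> has five elements; \<open>None\<close> is the first index and
  \<open>Some i\<close> is the index \<open>i\<close> within the lower block.\<close>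

definition block_mat :: "'a::field^4 \<Rightarrow> 'a^4^4 \<Rightarrow> 'a^(4 option)^(4 option)" where
  "block_mat v M = (\<chi> p q. case q of None \<Rightarrow> 0
      | Some j \<Rightarrow> (case p of None \<Rightarrow> v $ j | Some i \<Rightarrow> M $ i $ j))"

definition block_set :: "('a::field^4^4) set \<Rightarrow> ('a^(4 option)^(4 option)) set" where
  "block_set S = {block_mat v M | v M. M \<in> S}"

definition poincare :: "('a::field^(4 option)^(4 option)) set" where
  "poincare = block_set o4"

definition poincare_r :: "('a::field^(4 option)^(4 option)) set" where
  "poincare_r = block_set {0}"

definition poincare_i :: "('a::field^(4 option)^(4 option)) set" where
  "poincare_i = block_set o4_I"

definition poincare_j :: "('a::field^(4 option)^(4 option)) set" where
  "poincare_j = block_set o4_J"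

lemma block_mat_nth [simp]:
  "block_mat v M $ p $ None = 0"
  "block_mat v M $ None $ Some j = v $ j"
  "block_mat v M $ Some i $ Some j = M $ i $ j"
  by (simp_all add: block_mat_def split: option.splits)

lemma sum_option_UNIV:
  fixes f :: "'n::finite option \<Rightarrow> 'a::comm_monoid_add"
  shows "sum f UNIV = f None + (\<Sum>i\<in>UNIV. f (Some i))"
  by (simp add: UNIV_option_conv sum.reindex)

lemma block_mat_eq_iff: "block_mat v M = block_mat v' M' \<longleftrightarrow> v = v' \<and> M = M'"
proof
  assume eq: "block_mat v M = block_mat v' M'"
  have "v $ j = v' $ j" for j
    using arg_cong[OF eq, of "\<lambda>A. A $ None $ Some j"] by simp
  moreover have "M $ i $ j = M' $ i $ j" for i j
    using arg_cong[OF eq, of "\<lambda>A. A $ Some i $ Some j"] by simp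
  ultimately show "v = v' \<and> M = M'" by (simp add: vec_eq_iff)
qed simp

lemma block_mat_mult: "block_mat v M ** block_mat v' M' = block_mat (v v* M') (M ** M')"
proof -
  have "(block_mat v M ** block_mat v' M') $ p $ q = block_mat (v v* M') (M ** M') $ p $ q" for p q
    by (cases p; cases q)
       (simp_all add: matrix_matrix_mult_def vector_matrix_mult_def sum_option_UNIV)
  then show ?thesis by (simp add: vec_eq_iff)
qed

lemma block_mat_add: "block_mat v M + block_mat v' M' = block_mat (v + v') (M + M')"
  by (simp add: block_mat_def vec_eq_iff split: option.splits)

lemma block_mat_diff: "block_mat v M - block_mat v' M' = block_mat (v - v') (M - M')"
  by (simp add: block_mat_def vec_eq_iff split: option.splits)

lemma block_mat_scale: "matrix_scale c (block_mat v M) = block_mat (c *s v) (matrix_scale c M)"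
  by (simp add: block_mat_def matrix_scale_def vec_eq_iff split: option.splits)

lemma block_mat_zero: "block_mat 0 0 = 0"
  by (simp add: block_mat_def vec_eq_iff split: option.splits)

lemma lie_bracket_block_mat:
  "lie_bracket (block_mat v M) (block_mat v' M') =
     block_mat (v v* M' - v' v* M) (lie_bracket M M')"
  by (simp add: lie_bracket_def block_mat_mult block_mat_diff)

lemma lie_subalgebra_o4: "lie_subalgebra o4"
proof -
  have "transpose (A ** B - B ** A) = - (A ** B - B ** A)"
    if "transpose A = - A" "transpose B = - B" for A B :: "'a::field^4^4"
  proof -
    have "transpose (A ** B - B ** A) = transpose (A ** B) - transpose (B ** A)"
      by (simp add: transpose_def vec_eq_iff)
    also have "\<dots> = (- B) ** (- A) - (- A) ** (- B)"
      by (simp add: matrix_transpose_mul that)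
    also have "\<dots> = - (A ** B - B ** A)"
      by (simp add: matrix_matrix_mult_def vec_eq_iff)
    finally show ?thesis .
  qed
  moreover have "msp.subspace (o4 :: ('a^4^4) set)"
  proof (rule msp.subspaceI)
    show "(0 :: 'a^4^4) \<in> o4"
      by (simp add: o4_def transpose_def vec_eq_iff)
  next
    fix A B :: "'a^4^4" assume "A \<in> o4" "B \<in> o4"
    moreover have "transpose (A + B) = transpose A + transpose B"
      by (simp add: transpose_def vec_eq_iff)
    ultimately show "A + B \<in> o4" by (simp add: o4_def)
  next
    fix c and A :: "'a^4^4" assume "A \<in> o4"
    moreover have "transpose (matrix_scale c A) = matrix_scale c (transpose A)"
      by (simp add: transpose_def matrix_scale_def vec_eq_iff)
    ultimately show "matrix_scale c A \<in> o4" by (simp add: o4_def)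
  qed
  ultimately show ?thesis
    by (simp add: lie_subalgebra_def o4_def lie_bracket_def)
qed

lemma block_set_subspace:
  assumes "msp.subspace S"
  shows "msp.subspace (block_set S)"
proof (rule msp.subspaceI)
  show "0 \<in> block_set S"
    using msp.subspace_0[OF assms] block_mat_zero by (force simp: block_set_def)
next
  fix x y assume "x \<in> block_set S" "y \<in> block_set S"
  then show "x + y \<in> block_set S"
    using msp.subspace_add[OF assms] by (force simp: block_set_def block_mat_add)
next
  fix c x assume "x \<in> block_set S"
  then show "matrix_scale c x \<in> block_set S"
    using msp.subspace_scale[OF assms] by (force simp: block_set_def block_mat_scale)
qed

lemma lie_subalgebra_poincare: "lie_subalgebra poincare"
  unfolding lie_subalgebra_def
proof (intro conjI ballI)
  show "msp.subspace poincare"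
    unfolding poincare_def
    by (rule block_set_subspace) (rule lie_subalgebra_o4[unfolded lie_subalgebra_def, THEN conjunct1])
next
  fix x y :: "'a^(4 option)^(4 option)"
  assume "x \<in> poincare" "y \<in> poincare"
  then obtain v M v' M' where xy: "x = block_mat v M" "y = block_mat v' M'"
    and M: "M \<in> o4" "M' \<in> o4"
    unfolding poincare_def block_set_def by blast
  have "lie_bracket M M' \<in> o4"
    using M lie_subalgebra_o4[where 'a = 'a] unfolding lie_subalgebra_def by blast
  then show "lie_bracket x y \<in> poincare"
    unfolding xy poincare_def block_set_def lie_bracket_block_mat by blast
qed

end

theory Submission
  imports Defs
begin

text \<open>A nonzero ideal of \<open>poincare\<close> contains a nonzero pure translation: bracket an element
  having linear part \<open>M \<noteq> 0\<close> with a translation \<open>w\<close> such that \<open>w v* M \<noteq> 0\<close>. Since \<open>o4\<close>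
  acts irreducibly on row vectors, the ideal then contains all translations, so it is determined
  by its set of linear parts, which is an ideal of \<open>o4\<close>. In coordinates,
  \<open>o4\<close> is the direct sum of two commuting copies of three-space with (up to a factor) the cross
  product as bracket; double cross products of a nonzero vector with basis vectors already
  generate the whole copy. So only the four sums of copies are ideals.\<close>

section \<open>Skew-symmetric matrices\<close>

text \<open>If 2 = 0, the characteristic divides 2; being neither 0 nor 1, it equals 2.\<close>

lemma two_neq_0_if_CHAR_neq_2:
  assumes "CHAR('a::field) \<noteq> 2"
  shows "(2::'a) \<noteq> 0"
proof
  assume "(2::'a) = 0"
  then have "of_nat 2 = (0::'a)" by simp
  then have dvd: "CHAR('a) dvd 2" by (simp only: of_nat_eq_0_iff_char_dvd)
  then have "CHAR('a) \<le> 2" by (rule dvd_imp_le) simp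
  moreover have "CHAR('a) \<noteq> 0" using dvd by (metis dvd_0_left zero_neq_numeral)
  moreover have "CHAR('a) \<noteq> 1" by simp
  ultimately show False using assms by linarith
qed

lemma matrix_add_rdistrib: "(A + B) ** C = A ** C + B ** (C :: 'a::semiring_1^'p^'n)"
  by (simp add: matrix_matrix_mult_def vec_eq_iff distrib_right sum.distrib)

lemma lie_bracket_add_right: "lie_bracket A (B + C) = lie_bracket A B + lie_bracket A C"
  by (simp add: lie_bracket_def matrix_add_ldistrib matrix_add_rdistrib)

lemma lie_bracket_add_left: "lie_bracket (A + B) C = lie_bracket A C + lie_bracket B C"
  by (simp add: lie_bracket_def matrix_add_ldistrib matrix_add_rdistrib)

lemma lie_bracket_zero_right [simp]: "lie_bracket A 0 = 0"
  by (simp add: lie_bracket_def matrix_matrix_mult_def vec_eq_iff)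

lemma lie_bracket_zero_left [simp]: "lie_bracket 0 A = 0"
  by (simp add: lie_bracket_def matrix_matrix_mult_def vec_eq_iff)

lemma lie_ideal_zero: "0 \<in> g \<Longrightarrow> lie_ideal g {0}"
  by (auto simp: lie_ideal_def msp.subspace_def matrix_scale_def vec_eq_iff)

lemma lie_ideal_self: "lie_subalgebra g \<Longrightarrow> lie_ideal g g"
  by (simp add: lie_ideal_def lie_subalgebra_def)

lemma elem_mat_nth: "elem_mat i j $ k $ l = (if k = i \<and> l = j then 1 else 0)"
  by (cases "k = i"; cases "l = j") (simp_all add: elem_mat_def axis_def)

lemma skew_elem_nth: "skew_elem i j $ k $ l =
    (if k = i \<and> l = j then 1 else 0) - (if k = j \<and> l = i then 1 else 0)"
  unfolding skew_elem_def vector_minus_component elem_mat_nth ..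

lemma skew_elem_in_o4: "(skew_elem i j :: 'a::field^4^4) \<in> o4"
proof -
  have "transpose (skew_elem i j) $ k $ l = (- skew_elem i j :: 'a^4^4) $ k $ l" for k l
    unfolding transpose_def vec_lambda_beta vector_uminus_component skew_elem_nth minus_diff_eq
    by (simp only: conj_commute)
  then show ?thesis by (simp add: o4_def vec_eq_iff)
qed

text \<open>The matrices of \<open>o4_I\<close> (for \<open>s = 1\<close>) and \<open>o4_J\<close> (for \<open>s = -1\<close>) in coordinates.\<close>

definition quat_mat :: "'a::field \<Rightarrow> 'a \<Rightarrow> 'a \<Rightarrow> 'a \<Rightarrow> 'a^4^4" where
  "quat_mat s a b c =
     matrix_scale a (skew_elem 1 2 + matrix_scale s (skew_elem 3 4)) +
     matrix_scale b (skew_elem 1 3 - matrix_scale s (skew_elem 2 4)) +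
     matrix_scale c (skew_elem 1 4 + matrix_scale s (skew_elem 2 3))"

lemma quat_mat_nth [simp]:
  "quat_mat s a b c $ 1 $ 1 = 0"  "quat_mat s a b c $ 1 $ 2 = a"
  "quat_mat s a b c $ 1 $ 3 = b"  "quat_mat s a b c $ 1 $ 4 = c"
  "quat_mat s a b c $ 2 $ 1 = - a"  "quat_mat s a b c $ 2 $ 2 = 0"
  "quat_mat s a b c $ 2 $ 3 = s * c"  "quat_mat s a b c $ 2 $ 4 = - (s * b)"
  "quat_mat s a b c $ 3 $ 1 = - b"  "quat_mat s a b c $ 3 $ 2 = - (s * c)"
  "quat_mat s a b c $ 3 $ 3 = 0"  "quat_mat s a b c $ 3 $ 4 = s * a"
  "quat_mat s a b c $ 4 $ 1 = - c"  "quat_mat s a b c $ 4 $ 2 = s * b"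
  "quat_mat s a b c $ 4 $ 3 = - (s * a)"  "quat_mat s a b c $ 4 $ 4 = 0"
  by (simp_all add: quat_mat_def skew_elem_nth matrix_scale_def)

lemma quat_mat_add: "quat_mat s a b c + quat_mat s a' b' c' = quat_mat s (a + a') (b + b') (c + c')"
  by (simp add: vec_eq_iff forall_4 algebra_simps)

lemma quat_mat_scale: "matrix_scale k (quat_mat s a b c) = quat_mat s (k * a) (k * b) (k * c)"
  by (simp add: vec_eq_iff forall_4 algebra_simps matrix_scale_def)

lemma quat_mat_0 [simp]: "quat_mat s 0 0 0 = 0"
  by (simp add: vec_eq_iff forall_4)

lemma quat_mat_in_o4: "quat_mat s a b c \<in> o4"
  by (simp add: o4_def transpose_def vec_eq_iff forall_4)

text \<open>In the basis 1, i, j, k of the quaternion algebra with i^2 = j^2 = -1,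
  \<open>quat_mat s a b c\<close> acts on row vectors as left (\<open>s = 1\<close>) or right
  (\<open>s = -1\<close>) multiplication by ai + bj + ck. Hence the commutator is -2s times the
  cross product of the coordinate vectors.\<close>

lemma lie_bracket_quat_mat_same:
  assumes "s * s = 1"
  shows "lie_bracket (quat_mat s a b c) (quat_mat s a' b' c') =
    quat_mat s (2 * s * (c * b' - b * c')) (2 * s * (a * c' - c * a')) (2 * s * (b * a' - a * b'))"
  by (simp add: vec_eq_iff forall_4 lie_bracket_def matrix_matrix_mult_def sum_4 algebra_simps)
     (simp add: assms add.commute)

text \<open>Left and right quaternion multiplications commute by associativity.\<close>

lemma lie_bracket_quat_mat_opposite:
  assumes "s * s = 1"
  shows "lie_bracket (quat_mat s a b c) (quat_mat (- s) a' b' c') = 0"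
  by (simp add: vec_eq_iff forall_4 lie_bracket_def matrix_matrix_mult_def sum_4 algebra_simps)
     (simp add: assms add.commute)

definition quat_set :: "'a::field \<Rightarrow> ('a^4^4) set" where
  "quat_set s = {quat_mat s a b c | a b c. True}"

lemma quat_mat_in_quat_set [simp]: "quat_mat s a b c \<in> quat_set s"
  by (auto simp: quat_set_def)

lemma quat_setE:
  assumes "x \<in> quat_set s"
  obtains a b c where "x = quat_mat s a b c"
  using assms by (auto simp: quat_set_def)

lemma subspace_quat_set: "msp.subspace (quat_set s)"
proof (rule msp.subspaceI)
  show "0 \<in> quat_set s"
    by (metis quat_mat_0 quat_mat_in_quat_set)
next
  fix x y assume "x \<in> quat_set s" "y \<in> quat_set s"
  then show "x + y \<in> quat_set s"
    by (auto elim!: quat_setE simp: quat_mat_add)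
next
  fix c x assume "x \<in> quat_set s"
  then show "matrix_scale c x \<in> quat_set s"
    by (auto elim!: quat_setE simp: quat_mat_scale)
qed

lemma span_quat_mat:
  "msp.span {quat_mat s 1 0 0, quat_mat s 0 1 0, quat_mat s 0 0 1} = quat_set s" (is "msp.span ?B = _")
proof
  show "msp.span ?B \<subseteq> quat_set s"
    by (rule msp.span_minimal) (auto intro: subspace_quat_set)
  show "quat_set s \<subseteq> msp.span ?B"
  proof
    fix x assume "x \<in> quat_set s"
    then obtain a b c where x: "x = quat_mat s a b c" by (rule quat_setE)
    have "x = matrix_scale a (quat_mat s 1 0 0) + matrix_scale b (quat_mat s 0 1 0)
        + matrix_scale c (quat_mat s 0 0 1)"
      by (simp add: x quat_mat_scale quat_mat_add)
    moreover have "quat_mat s 1 0 0 \<in> msp.span ?B" "quat_mat s 0 1 0 \<in> msp.span ?B"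
      "quat_mat s 0 0 1 \<in> msp.span ?B"
      by (simp_all add: msp.span_base)
    ultimately show "x \<in> msp.span ?B"
      by (simp only: msp.span_add msp.span_scale)
  qed
qed

lemma o4_I_eq: "(o4_I :: ('a::field^4^4) set) = quat_set 1"
proof -
  have "skew_elem 1 2 + skew_elem 3 4 = (quat_mat 1 1 0 0 :: 'a^4^4)"
    "skew_elem 1 3 - skew_elem 2 4 = (quat_mat 1 0 1 0 :: 'a^4^4)"
    "skew_elem 1 4 + skew_elem 2 3 = (quat_mat 1 0 0 1 :: 'a^4^4)"
    by (simp_all add: vec_eq_iff forall_4 skew_elem_nth)
  then show ?thesis by (simp add: o4_I_def span_quat_mat)
qed

lemma o4_J_eq: "(o4_J :: ('a::field^4^4) set) = quat_set (-1)"
proof -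
  have "skew_elem 1 2 - skew_elem 3 4 = (quat_mat (-1) 1 0 0 :: 'a^4^4)"
    "skew_elem 1 3 + skew_elem 2 4 = (quat_mat (-1) 0 1 0 :: 'a^4^4)"
    "skew_elem 1 4 - skew_elem 2 3 = (quat_mat (-1) 0 0 1 :: 'a^4^4)"
    by (simp_all add: vec_eq_iff forall_4 skew_elem_nth)
  then show ?thesis by (simp add: o4_J_def span_quat_mat)
qed

text \<open>The entries above the diagonal pair up as (12, 34), (13, 24), (14, 23). Up to sign, each
  pair consists of the sum and the difference of one coordinate from either copy, so halving
  recovers both.\<close>

lemma o4_decompose:
  fixes M :: "'a::field^4^4"
  assumes two: "(2::'a) \<noteq> 0" and M: "M \<in> o4"
  obtains a b c d e f where "M = quat_mat 1 a b c + quat_mat (-1) d e f"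
proof -
  have M': "transpose M = - M" using M by (simp only: o4_def mem_Collect_eq)
  have skew: "M $ j $ i = - M $ i $ j" for i j
  proof -
    have "M $ j $ i = transpose M $ i $ j" by (simp only: transpose_def vec_lambda_beta)
    then show ?thesis by (simp only: M' vector_uminus_component)
  qed
  have diag: "M $ i $ i = 0" for i
  proof -
    have "2 * M $ i $ i = M $ i $ i + M $ i $ i" by (rule mult_2)
    also have "\<dots> = 0" by (subst skew) simp
    finally show ?thesis using two by simp
  qed
  have lower: "M $ 2 $ 1 = - M $ 1 $ 2" "M $ 3 $ 1 = - M $ 1 $ 3" "M $ 4 $ 1 = - M $ 1 $ 4"
    "M $ 3 $ 2 = - M $ 2 $ 3" "M $ 4 $ 2 = - M $ 2 $ 4" "M $ 4 $ 3 = - M $ 3 $ 4"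
    by (rule skew)+
  \<comment> \<open>For clearing denominators in \<open>split\<close>, where the two denominators 2
    multiply to 4.\<close>
  have "(4::'a) = 2 * 2" by simp
  then have four: "(4::'a) \<noteq> 0" using two by (metis mult_eq_0_iff)
  have split: "\<exists>x y. p = x + y \<and> q = x - y" for p q :: 'a
    by (rule exI[of _ "(p + q) / 2"], rule exI[of _ "(p - q) / 2"])
       (use two four in \<open>simp add: field_simps\<close>)
  obtain a d where 1: "M $ 1 $ 2 = a + d" "M $ 3 $ 4 = a - d" using split by blast
  \<comment> \<open>Here \<open>e\<close> comes first because entry (2, 4) of
    \<open>quat_mat s a b c\<close> is \<open>- (s * b)\<close>, with the sign opposite to that in
    the other two pairs.\<close>
  obtain b e where 2: "M $ 1 $ 3 = e + b" "M $ 2 $ 4 = e - b" using split by blast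
  obtain c f where 3: "M $ 1 $ 4 = c + f" "M $ 2 $ 3 = c - f" using split by blast
  have "M = quat_mat 1 a b c + quat_mat (-1) d e f"
    by (simp add: vec_eq_iff forall_4 lower diag 1 2 3)
  then show thesis by (rule that)
qed

section \<open>Ideals of the skew-symmetric matrices\<close>

text \<open>The component of \<open>x\<close> in the opposite copy commutes with \<open>y\<close>;
  the bracket of the other component with \<open>y\<close> stays in the copy by the cross product
  formula.\<close>

lemma lie_ideal_quat_set:
  fixes s :: "'a::field"
  assumes two: "(2::'a) \<noteq> 0" and s: "s = 1 \<or> s = -1"
  shows "lie_ideal o4 (quat_set s)"
  unfolding lie_ideal_def
proof (intro conjI ballI)
  show "quat_set s \<subseteq> o4" by (auto simp: quat_set_def quat_mat_in_o4)
  show "msp.subspace (quat_set s)" by (rule subspace_quat_set)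
  fix x y :: "'a^4^4" assume "x \<in> o4" "y \<in> quat_set s"
  then obtain a b c where y: "y = quat_mat s a b c" by (auto elim: quat_setE)
  obtain a1 b1 c1 d1 e1 f1 where "x = quat_mat 1 a1 b1 c1 + quat_mat (-1) d1 e1 f1"
    using o4_decompose[OF two \<open>x \<in> o4\<close>] .
  \<comment> \<open>For \<open>s = -1\<close> the two summands trade places.\<close>
  with s obtain a2 b2 c2 d2 e2 f2 where x: "x = quat_mat s a2 b2 c2 + quat_mat (- s) d2 e2 f2"
    by (metis add.commute minus_minus)
  have "lie_bracket (quat_mat (- s) d2 e2 f2) y = 0"
    using lie_bracket_quat_mat_opposite[of "- s"] s y by auto
  moreover have "s * s = 1" using s by auto
  ultimately show "lie_bracket x y \<in> quat_set s"
    using lie_bracket_quat_mat_same[of s] by (simp add: x y lie_bracket_add_left)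
qed

text \<open>Bracketing with elements of the copy \<open>s\<close> annihilates the opposite component
  and takes cross products on the other. Crossing with basis vectors e1, e2, e3 brings a nonzero
  coordinate alone onto the first axis, and from there every axis is reached.\<close>

lemma quat_set_subset_lie_ideal:
  fixes s :: "'a::field"
  assumes two: "(2::'a) \<noteq> 0" and s: "s * s = 1" and S: "lie_ideal o4 S"
    and M: "quat_mat s a b c + quat_mat (- s) d e f \<in> S"
    and nz: "a \<noteq> 0 \<or> b \<noteq> 0 \<or> c \<noteq> 0"
  shows "quat_set s \<subseteq> S"
proof -
  have add: "x + y \<in> S" if "x \<in> S" "y \<in> S" for x y
    using S that msp.subspace_add unfolding lie_ideal_def by blast
  have scale: "matrix_scale k x \<in> S" if "x \<in> S" for k x
    using S that msp.subspace_scale unfolding lie_ideal_def by blast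
  \<comment> \<open>Since s is its own inverse, the factor \<open>s / 2\<close> cancels the 2s of
    the bracket formula and leaves a bare cross product.\<close>
  have half: "s / 2 * (2 * s * t) = t" for t
    using two s by simp
  have cross': "quat_mat s (z * b - y * c) (x * c - z * a) (y * a - x * b) \<in> S"
    if "quat_mat s a b c + quat_mat (- s) d e f \<in> S" for x y z a b c d e f
  proof -
    have "lie_bracket (quat_mat s x y z) (quat_mat s a b c + quat_mat (- s) d e f) \<in> S"
      using S that quat_mat_in_o4 unfolding lie_ideal_def by blast
    then have "matrix_scale (s / 2) (lie_bracket (quat_mat s x y z) (quat_mat s a b c)) \<in> S"
      by (simp add: lie_bracket_add_right lie_bracket_quat_mat_opposite s scale)
    then show ?thesis
      by (simp only: lie_bracket_quat_mat_same s quat_mat_scale half)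
  qed
  have cross: "quat_mat s (z * b - y * c) (x * c - z * a) (y * a - x * b) \<in> S"
    if "quat_mat s a b c \<in> S" for x y z a b c
    using cross'[of a b c 0 0 0] that by simp
  obtain k where k: "k \<noteq> 0" "quat_mat s k 0 0 \<in> S"
  proof -
    consider "a \<noteq> 0" | "b \<noteq> 0" | "c \<noteq> 0" using nz by blast
    then show thesis
    proof cases
      case 1
      \<comment> \<open>Crossing twice with e2 removes b, twice with e3 removes c. Each pair negates
        what it keeps, so a survives with its sign.\<close>
      have "quat_mat s (- c) 0 a \<in> S" using cross'[OF M, where x=0 and y=1 and z=0] by simp
      from cross[OF this, where x=0 and y=1 and z=0] have "quat_mat s (- a) 0 (- c) \<in> S" by simp
      from cross[OF this, where x=0 and y=0 and z=1] have "quat_mat s 0 a 0 \<in> S" by simp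
      from cross[OF this, where x=0 and y=0 and z=1] have "quat_mat s a 0 0 \<in> S" by simp
      with 1 show thesis by (rule that)
    next
      case 2
      \<comment> \<open>Crossing with e1 removes a; crossing with e2 then removes c and turns b onto
        the first axis. In the third case e3 does the same for c.\<close>
      have "quat_mat s 0 c (- b) \<in> S" using cross'[OF M, where x=1 and y=0 and z=0] by simp
      from cross[OF this, where x=0 and y=1 and z=0] have "quat_mat s b 0 0 \<in> S" by simp
      with 2 show thesis by (rule that)
    next
      case 3
      have "quat_mat s 0 c (- b) \<in> S" using cross'[OF M, where x=1 and y=0 and z=0] by simp
      from cross[OF this, where x=0 and y=0 and z=1] have "quat_mat s c 0 0 \<in> S" by simp
      with 3 show thesis by (rule that)
    qed
  qed
  have 1: "quat_mat s t 0 0 \<in> S" for t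
    using scale[OF k(2), of "t / k"] k(1) by (simp add: quat_mat_scale)
  \<comment> \<open>Crossing with -e3 carries e1 to e2, and crossing with e2 carries e1 to
    e3.\<close>
  have 2: "quat_mat s 0 t 0 \<in> S" for t using cross[OF 1[of t], where x=0 and y=0 and z="-1"] by simp
  have 3: "quat_mat s 0 0 t \<in> S" for t using cross[OF 1[of t], where x=0 and y=1 and z=0] by simp
  have "quat_mat s x y z \<in> S" for x y z
    using add[OF add[OF 1[of x] 2[of y]] 3[of z]] by (simp add: quat_mat_add)
  then show ?thesis by (auto simp: quat_set_def)
qed

text \<open>A single element with a nonzero component in one copy forces that whole copy into
  \<open>S\<close>. So for each copy, either \<open>S\<close> contains it or \<open>S\<close> lies
  in the other one, and the four combinations give the four ideals.\<close>

lemma lie_ideals_o4: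
  assumes two: "(2::'a::field) \<noteq> 0"
  shows "{S :: ('a^4^4) set. lie_ideal o4 S} = {{0}, o4_I, o4_J, o4}"
proof (intro equalityI subsetI)
  fix S :: "('a^4^4) set"
  assume "S \<in> {{0}, o4_I, o4_J, o4}"
  moreover have "lie_ideal o4 (o4 :: ('a^4^4) set)"
    by (rule lie_ideal_self[OF lie_subalgebra_o4])
  moreover have "lie_ideal o4 {0 :: 'a^4^4}"
    using lie_subalgebra_o4[where 'a = 'a]
    by (intro lie_ideal_zero msp.subspace_0) (simp add: lie_subalgebra_def)
  ultimately show "S \<in> {S. lie_ideal o4 S}"
    using lie_ideal_quat_set[OF two] by (auto simp: o4_I_eq o4_J_eq)
next
  fix S :: "('a^4^4) set"
  assume "S \<in> {S. lie_ideal o4 S}"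
  then have S: "lie_ideal o4 S" by simp
  then have sub: "S \<subseteq> o4" and subsp: "msp.subspace S" by (auto simp: lie_ideal_def)
  have I: "o4_I \<subseteq> S" if "quat_mat 1 a b c + quat_mat (-1) d e f \<in> S" "\<not> (a = 0 \<and> b = 0 \<and> c = 0)"
    for a b c d e f
    unfolding o4_I_eq by (rule quat_set_subset_lie_ideal[OF two _ S that(1)]) (use that in auto)
  have J: "o4_J \<subseteq> S" if "quat_mat 1 a b c + quat_mat (-1) d e f \<in> S" "\<not> (d = 0 \<and> e = 0 \<and> f = 0)"
    for a b c d e f
    \<comment> \<open>For \<open>s = -1\<close> the summands exchange roles, hence the reordered
      instantiation.\<close>
    unfolding o4_J_eq
    by (rule quat_set_subset_lie_ideal[OF two _ S, of "-1" d e f a b c])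
       (use that in \<open>auto simp: add.commute\<close>)
  have dec: "\<exists>a b c d e f. M = quat_mat 1 a b c + quat_mat (-1) d e f" if M: "M \<in> S" for M
  proof -
    obtain a b c d e f where "M = quat_mat 1 a b c + quat_mat (-1) d e f"
      using o4_decompose[OF two subsetD[OF sub M]] .
    then show ?thesis by blast
  qed
  have in_J: "S \<subseteq> o4_J" if "\<not> o4_I \<subseteq> S"
  proof
    fix M assume M: "M \<in> S"
    then obtain a b c d e f where "M = quat_mat 1 a b c + quat_mat (-1) d e f" using dec by blast
    moreover from this have "a = 0 \<and> b = 0 \<and> c = 0" using I that M by blast
    ultimately show "M \<in> o4_J" by (simp add: o4_J_eq)
  qed
  have in_I: "S \<subseteq> o4_I" if "\<not> o4_J \<subseteq> S"
  proof
    fix M assume M: "M \<in> S"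
    then obtain a b c d e f where "M = quat_mat 1 a b c + quat_mat (-1) d e f" using dec by blast
    moreover from this have "d = 0 \<and> e = 0 \<and> f = 0" using J that M by blast
    ultimately show "M \<in> o4_I" by (simp add: o4_I_eq)
  qed
  have "S = {0}" if "\<not> o4_I \<subseteq> S" "\<not> o4_J \<subseteq> S"
  proof -
    have "M = 0" if M: "M \<in> S" for M
    proof -
      obtain a b c d e f where M': "M = quat_mat 1 a b c + quat_mat (-1) d e f"
        using dec[OF M] by blast
      have "a = 0 \<and> b = 0 \<and> c = 0" using I[of a b c d e f] \<open>\<not> o4_I \<subseteq> S\<close> M M' by blast
      moreover have "d = 0 \<and> e = 0 \<and> f = 0" using J[of a b c d e f] \<open>\<not> o4_J \<subseteq> S\<close> M M' by blast
      ultimately show ?thesis using M' by simp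
    qed
    then show ?thesis using msp.subspace_0[OF subsp] by auto
  qed
  moreover have "S = o4" if "o4_I \<subseteq> S" "o4_J \<subseteq> S"
  proof -
    have "M \<in> S" if M: "M \<in> o4" for M
    proof -
      obtain a b c d e f where "M = quat_mat 1 a b c + quat_mat (-1) d e f"
        using o4_decompose[OF two M] .
      moreover have "quat_mat 1 a b c \<in> S" "quat_mat (-1) d e f \<in> S"
        using \<open>o4_I \<subseteq> S\<close> \<open>o4_J \<subseteq> S\<close> by (auto simp: o4_I_eq o4_J_eq)
      ultimately show ?thesis using msp.subspace_add[OF subsp] by blast
    qed
    then show ?thesis using sub by auto
  qed
  ultimately show "S \<in> {{0}, o4_I, o4_J, o4}" using in_I in_J by blast
qed

section \<open>Ideals of the Poincare algebra\<close>

lemma vector_skew_elem: "(v::'a::field^4) v* skew_elem i j = axis j (v $ i) - axis i (v $ j)"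
proof -
  have "v $ l * skew_elem i j $ l $ k =
      (if l = i then if k = j then v $ l else 0 else 0) -
      (if l = j then if k = i then v $ l else 0 else 0)" for k l
    by (simp add: skew_elem_nth)
  then have "(v v* skew_elem i j) $ k = (axis j (v $ i) - axis i (v $ j)) $ k" for k
    by (simp add: vector_matrix_mult_def sum_subtractf axis_def mult.commute)
  then show ?thesis by (simp add: vec_eq_iff)
qed

text \<open>Two elementary skew matrices carry a nonzero coordinate of \<open>v\<close> onto any
  other axis and discard the rest; one more leads back to the original axis.\<close>

lemma o4_invariant_subspace_eq_UNIV:
  fixes V :: "('a::field^4) set"
  assumes add: "\<And>x y. x \<in> V \<Longrightarrow> y \<in> V \<Longrightarrow> x + y \<in> V"
    and scale: "\<And>k x. x \<in> V \<Longrightarrow> k *s x \<in> V"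
    and act: "\<And>x N. x \<in> V \<Longrightarrow> N \<in> o4 \<Longrightarrow> x v* N \<in> V"
    and v: "v \<in> V" "v \<noteq> 0"
  shows "V = UNIV"
proof -
  have third: "\<exists>j. j \<noteq> k \<and> j \<noteq> l" for k l :: 4
  proof -
    have "card {k, l} < CARD(4)" by (simp add: card_insert_if)
    then have "{k, l} \<noteq> UNIV" by force
    then show ?thesis by blast
  qed
  obtain i where i: "v $ i \<noteq> 0" using v(2) by (auto simp: vec_eq_iff)
  have [simp]: "axis p 0 = (0 :: 'a^4)" "axis p a $ q = (if q = p then a else 0)"
    for p q :: 4 and a :: 'a
    by (simp_all add: axis_def vec_eq_iff)
  have act': "axis j (x $ i) - axis i (x $ j) \<in> V" if "x \<in> V" for x i j
    using act[OF that skew_elem_in_o4[of i j]] by (simp add: vector_skew_elem)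
  have "axis k t \<in> V" if "k \<noteq> i" for k t
  proof -
    obtain j where j: "j \<noteq> i" "j \<noteq> k" using third by blast
    \<comment> \<open>Acting by \<open>skew_elem i j\<close> leaves only v_i on axis j and -v_j on
      axis i; then \<open>skew_elem j k\<close> moves v_i to axis k and kills axis i, as i, j, k are
      distinct.\<close>
    have "axis k (v $ i) \<in> V"
      using act'[OF act'[OF v(1), of j i], of k j] j that by simp
    moreover have "(t / v $ i) *s axis k (v $ i) = axis k t"
      using i by (simp add: vec_eq_iff)
    ultimately show ?thesis using scale by metis
  qed
  note off = this
  have "axis i t \<in> V" for t
  proof -
    obtain j where j: "j \<noteq> i" using third by blast
    show ?thesis using act'[OF off[OF j, of t], of i j] j by simp
  qed
  with off have ax: "axis k t \<in> V" for k t by (cases "k = i") auto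
  have "w \<in> V" for w
  proof -
    have "w = axis 1 (w $ 1) + axis 2 (w $ 2) + axis 3 (w $ 3) + axis 4 (w $ 4)"
      by (simp add: vec_eq_iff forall_4 axis_def)
    then show ?thesis by (metis add ax)
  qed
  then show ?thesis by auto
qed

text \<open>Bracketing with a pure linear part \<open>N\<close> sends a translation \<open>x\<close>
  to \<open>- (x v* N)\<close>. The translations in \<open>h\<close> thus form an
  \<open>o4\<close>-stable subspace, and irreducibility applies once one of them is nonzero.\<close>

lemma lie_ideal_poincare_translations:
  fixes h :: "('a::field^(4 option)^(4 option)) set"
  assumes h: "lie_ideal poincare h" "h \<noteq> {0}"
  shows "block_mat w 0 \<in> h"
proof -
  have sub: "h \<subseteq> poincare" and subsp: "msp.subspace h"
    and br: "\<And>x y. x \<in> poincare \<Longrightarrow> y \<in> h \<Longrightarrow> lie_bracket x y \<in> h"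
    using h(1) by (auto simp: lie_ideal_def)
  have o4_0: "(0 :: 'a^4^4) \<in> o4"
    using lie_subalgebra_o4[where 'a = 'a] msp.subspace_0 unfolding lie_subalgebra_def by blast
  have in_p: "block_mat u N \<in> poincare" if "N \<in> o4" for u and N :: "'a^4^4"
    using that unfolding poincare_def block_set_def by blast
  let ?V = "{v :: 'a^4. block_mat v 0 \<in> h}"
  obtain x where x: "x \<in> h" "x \<noteq> 0"
    using h(2) msp.subspace_0[OF subsp] by blast
  then obtain v M where vM: "x = block_mat v M"
    using sub unfolding poincare_def block_set_def by blast
  obtain u where u: "u \<in> ?V" "u \<noteq> 0"
  proof (cases "M = 0")
    case True
    then have "v \<noteq> 0" using x vM by (auto simp: block_mat_zero)
    then show thesis using that[of v] x vM True by simp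
  next
    case False
    then obtain i j where ij: "M $ i $ j \<noteq> 0" by (auto simp: vec_eq_iff)
    \<comment> \<open>The bracket with the i-th unit translation extracts row i of \<open>M\<close>
      as a translation, nonzero by the choice of i.\<close>
    have "lie_bracket (block_mat (axis i 1) 0) x \<in> h" by (rule br[OF in_p[OF o4_0] x(1)])
    then have "block_mat (axis i 1 v* M) 0 \<in> h"
      by (simp add: vM lie_bracket_block_mat)
    moreover have "(axis i 1 v* M) $ j = (\<Sum>l\<in>UNIV. if l = i then M $ l $ j else 0)"
      unfolding vector_matrix_mult_def vec_lambda_beta
      by (rule sum.cong) (simp_all add: axis_def)
    then have "(axis i 1 v* M) $ j = M $ i $ j" by simp
    ultimately show thesis using that ij by fastforce
  qed
  have "?V = UNIV"
  proof (rule o4_invariant_subspace_eq_UNIV[OF _ _ _ u])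
    fix x y assume "x \<in> ?V" "y \<in> ?V"
    then show "x + y \<in> ?V"
      using msp.subspace_add[OF subsp, of "block_mat x 0" "block_mat y 0"] by (simp add: block_mat_add)
  next
    fix k x assume "x \<in> ?V"
    moreover have "matrix_scale k 0 = (0::'a^4^4)" by (simp add: matrix_scale_def vec_eq_iff)
    ultimately show "k *s x \<in> ?V"
      using msp.subspace_scale[OF subsp, of "block_mat x 0" k] by (simp add: block_mat_scale)
  next
    fix x and N :: "'a^4^4" assume "x \<in> ?V" and N: "N \<in> o4"
    then have "lie_bracket (block_mat 0 N) (block_mat x 0) \<in> h"
      using br in_p by blast
    then have "block_mat (- (x v* N)) 0 \<in> h" by (simp add: lie_bracket_block_mat)
    from msp.subspace_neg[OF subsp this] show "x v* N \<in> ?V"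
      using block_mat_diff[of 0 0 "- (x v* N)" 0] by (simp add: block_mat_zero)
  qed
  then show ?thesis by blast
qed

text \<open>The zero ideal stands apart because every \<open>block_set S\<close> with
  \<open>S\<close> nonempty contains all translations. So does every nonzero ideal, which is
  therefore determined by its linear parts.\<close>

lemma lie_ideal_poincare_iff:
  fixes h :: "('a::field^(4 option)^(4 option)) set"
  shows "lie_ideal poincare h \<longleftrightarrow> h = {0} \<or> (\<exists>S. lie_ideal o4 S \<and> h = block_set S)"
proof
  assume h: "lie_ideal poincare h"
  then have sub: "h \<subseteq> poincare" and subsp: "msp.subspace h"
    and br: "\<And>x y. x \<in> poincare \<Longrightarrow> y \<in> h \<Longrightarrow> lie_bracket x y \<in> h"
    by (auto simp: lie_ideal_def)
  show "h = {0} \<or> (\<exists>S. lie_ideal o4 S \<and> h = block_set S)"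
  proof (cases "h = {0}")
    case False
    define S where "S = {M. block_mat 0 M \<in> h}"
    have tr: "block_mat w 0 \<in> h" for w by (rule lie_ideal_poincare_translations[OF h False])
    \<comment> \<open>Adding the translation by \<open>v\<close> or \<open>- v\<close>, both in
      \<open>h\<close>, passes between \<open>block_mat 0 M\<close> and
      \<open>block_mat v M\<close>.\<close>
    have iff: "block_mat v M \<in> h \<longleftrightarrow> M \<in> S" for v M
      using msp.subspace_add[OF subsp, of "block_mat 0 M" "block_mat v 0"]
        msp.subspace_add[OF subsp, of "block_mat v M" "block_mat (- v) 0"] tr
      by (auto simp: S_def block_mat_add)
    have "h = block_set S"
      using sub iff unfolding poincare_def block_set_def by blast
    moreover have "lie_ideal o4 S"
      unfolding lie_ideal_def
    proof (intro conjI ballI)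
      show "S \<subseteq> o4"
        using sub by (auto simp: S_def poincare_def block_set_def block_mat_eq_iff)
      show "msp.subspace S"
      proof (rule msp.subspaceI)
        show "0 \<in> S" using tr iff by blast
      next
        fix x y assume "x \<in> S" "y \<in> S"
        then show "x + y \<in> S"
          using msp.subspace_add[OF subsp, of "block_mat 0 x" "block_mat 0 y"]
          by (simp add: S_def block_mat_add)
      next
        fix k x assume "x \<in> S"
        then show "matrix_scale k x \<in> S"
          using msp.subspace_scale[OF subsp, of "block_mat 0 x" k]
          by (simp add: S_def block_mat_scale)
      qed
      fix x y :: "'a^4^4" assume "x \<in> o4" "y \<in> S"
      then have "lie_bracket (block_mat 0 x) (block_mat 0 y) \<in> h"
        by (intro br) (auto simp: S_def poincare_def block_set_def)
      then show "lie_bracket x y \<in> S" by (simp add: lie_bracket_block_mat iff)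
    qed
    ultimately show ?thesis by blast
  qed simp
next
  assume "h = {0} \<or> (\<exists>S. lie_ideal o4 S \<and> h = block_set S)"
  then show "lie_ideal poincare h"
  proof (elim disjE exE conjE)
    assume "h = {0}"
    moreover have "0 \<in> (poincare :: ('a^(4 option)^(4 option)) set)"
      using lie_subalgebra_poincare msp.subspace_0 unfolding lie_subalgebra_def by blast
    ultimately show ?thesis by (simp add: lie_ideal_zero)
  next
    fix S :: "('a^4^4) set" assume S: "lie_ideal o4 S" and h: "h = block_set S"
    show ?thesis
      unfolding lie_ideal_def
    proof (intro conjI ballI)
      show "h \<subseteq> poincare"
        using S unfolding h poincare_def block_set_def lie_ideal_def by blast
      show "msp.subspace h"
        using S unfolding h lie_ideal_def by (intro block_set_subspace) blast
      fix x y :: "'a^(4 option)^(4 option)" assume "x \<in> poincare" "y \<in> h"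
      then obtain v M w N where "x = block_mat v M" "M \<in> o4" "y = block_mat w N" "N \<in> S"
        unfolding h poincare_def block_set_def by blast
      moreover from this have "lie_bracket M N \<in> S" using S unfolding lie_ideal_def by blast
      ultimately show "lie_bracket x y \<in> h"
        unfolding h block_set_def by (auto simp: lie_bracket_block_mat)
    qed
  qed
qed

theorem lemma17:
  assumes "CHAR('a::alg_closed_field) \<noteq> 2"
  shows "{h :: ('a^(4 option)^(4 option)) set. lie_ideal poincare h} =
           {{0}, poincare_r, poincare_i, poincare_j, poincare}"
proof -
  have "lie_ideal o4 S \<longleftrightarrow> S = {0} \<or> S = o4_I \<or> S = o4_J \<or> S = o4" for S :: "('a^4^4) set"
    using lie_ideals_o4[OF two_neq_0_if_CHAR_neq_2[OF assms]] by blast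
  \<comment> \<open>The four ideals of \<open>o4\<close> yield the four nonzero ideals through
    \<open>block_set\<close>; the zero ideal is the fifth.\<close>
  then show ?thesis
    unfolding poincare_r_def poincare_i_def poincare_j_def
    by (simp only: lie_ideal_poincare_iff) (auto simp only: poincare_def)
qed

end
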